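(* Let $M$ be an increasing Puiseux monoid. Then the following statements hold. (1) $M$ is nowhere dense. (2) The conductor $\mathfrak{c}(M)$ is nonempty if and only if $M$ is finitely generated.
   Context: A Puiseux monoid is an additive submonoid of $(\mathbb{Q}_{\ge 0},+)$. For a subset $S$ of a Puiseux monoid $M$, $S$ generates $M$ (is a generating set of $M$) if no proper submonoid of $M$ contains $S$; $M$ is finitely generated if it has a finite generating set. A Puiseux monoid $M$ is increasing if it can be generated by (the underlying set of) an increasing sequence $(a_n)_{n\in\mathbb{N}}$, i.e. a sequence of rationals in $M$ with $a_n \le a_{n+1}$ for all $n$. For $A, B \subseteq \mathbb{R}$, $A$ is dense in $B$ if $A\cap B$ is a dense subset of $B$ with the Euclidean subspace topology. A Puiseux monoid $M$ is nowhere dense if for all $r,s \in \mathbb{R}_{\ge 0}$ with $r<s$, $M$ is not dense in the open interval $(r,s)$. The difference group of a Puiseux monoid $M$ is the subgroup $\mathrm{gp}(M) = \{x-y \mid x,y\in M\}$ of $(\mathbb{Q},+)$; its root closure is $\widetilde{M} = \{x\in \mathrm{gp}(M) \mid nx\in M \text{ for some } n\in\mathbb{N}\}$, where $\mathbb{N}$ is the set of positive integers; its conductor is $\mathfrak{c}(M) = \{x\in \mathrm{gp}(M) \mid x+\widetilde{M}\subseteq M\}$. *)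

theory Defs
  imports "HOL-Analysis.Analysis"
begin

definition additive_submonoid :: "'a::comm_monoid_add set \<Rightarrow> bool" where
  "additive_submonoid N \<longleftrightarrow> 0 \<in> N \<and> (\<forall>x\<in>N. \<forall>y\<in>N. x + y \<in> N)"

definition puiseux_monoid :: "rat set \<Rightarrow> bool" where
  "puiseux_monoid M \<longleftrightarrow> M \<subseteq> {0..} \<and> additive_submonoid M"

definition generates :: "rat set \<Rightarrow> rat set \<Rightarrow> bool" where
  "generates S M \<longleftrightarrow>
     S \<subseteq> M \<and> \<not> (\<exists>N. additive_submonoid N \<and> N \<subset> M \<and> S \<subseteq> N)"

definition finitely_generated :: "rat set \<Rightarrow> bool" where
  "finitely_generated M \<longleftrightarrow> (\<exists>S. finite S \<and> generates S M)"

(* Increasing is meant in the weak sense; incseq states monotonicity with \<le>. *)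
definition increasing_puiseux :: "rat set \<Rightarrow> bool" where
  "increasing_puiseux M \<longleftrightarrow> (\<exists>a :: nat \<Rightarrow> rat. incseq a \<and> generates (range a) M)"

(* A is not required to be a subset of B. *)
definition dense_in :: "real set \<Rightarrow> real set \<Rightarrow> bool" where
  "dense_in A B \<longleftrightarrow> top_of_set B closure_of (A \<inter> B) = B"

(* For a set of nonnegative rationals, regarded as a subset of the real line: only
   intervals with nonnegative endpoints are tested. *)
definition nowhere_dense_puiseux :: "rat set \<Rightarrow> bool" where
  "nowhere_dense_puiseux M \<longleftrightarrow>
     (\<forall>r s :: real. 0 \<le> r \<and> 0 \<le> s \<and> r < s \<longrightarrow> \<not> dense_in (real_of_rat ` M) {r<..<s})"

definition difference_group :: "rat set \<Rightarrow> rat set" where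
  "difference_group M = {x - y | x y. x \<in> M \<and> y \<in> M}"

definition root_closure :: "rat set \<Rightarrow> rat set" where
  "root_closure M = {x \<in> difference_group M. \<exists>n::nat. n > 0 \<and> of_nat n * x \<in> M}"

definition conductor :: "rat set \<Rightarrow> rat set" where
  "conductor M = {x \<in> difference_group M. (\<lambda>y. x + y) ` root_closure M \<subseteq> M}"

end

theory Submission
  imports Defs
begin

text \<open>
  The key point is that an increasing Puiseux monoid is well-ordered: below a fixed bound only
  sums of boundedly many generators occur, and a sumset of two well-ordered sets is well-ordered,
  because every sequence has a monotone subsequence.  A well-ordered set is not dense in
  an interval, which gives (1).  If \<open>x\<close> lies in the conductor, then \<open>M\<close> contains \<open>x + g\<close> for every
  positive \<open>g\<close> of the difference group, so the positive part of that group has a least element;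
  hence \<open>M\<close> is discrete, and for \<open>0 < m \<in> M\<close> it is generated by \<open>m\<close> and its finitely many elements
  below \<open>x + m\<close>.  Conversely, if \<open>M\<close> is finitely generated, then its difference group has
  only finitely many elements in \<open>[0, m)\<close>, and a common subtrahend for them lies in the conductor.
\<close>

section \<open>Submonoids and generation\<close>

lemma additive_submonoid_of_nat_mult:
  fixes x :: "'a::semiring_1"
  assumes "additive_submonoid M" "x \<in> M"
  shows "of_nat n * x \<in> M"
  using assms by (induction n) (auto simp: additive_submonoid_def distrib_right)

lemma additive_submonoid_sum:
  assumes "additive_submonoid M" "\<And>i. i \<in> A \<Longrightarrow> f i \<in> M"
  shows "sum f A \<in> M"
  using assms(2)
  by (induction A rule: infinite_finite_induct)
     (use assms(1) in \<open>auto simp: additive_submonoid_def\<close>)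

text \<open>The elements of \<open>M\<close> with property \<open>P\<close> form a submonoid
  containing \<open>S\<close>, which by minimality cannot be proper. This replaces writing elements
  of \<open>M\<close> as explicit finite sums of generators.\<close>

lemma generates_induct [consumes 3, case_names zero gen add]:
  assumes "generates S M" "additive_submonoid M" "x \<in> M"
    and "P 0" "\<And>s. s \<in> S \<Longrightarrow> P s" "\<And>x y. P x \<Longrightarrow> P y \<Longrightarrow> P (x + y)"
  shows "P x"
proof -
  let ?N = "{x \<in> M. P x}"
  have "additive_submonoid ?N" "S \<subseteq> ?N"
    using assms by (auto simp: additive_submonoid_def generates_def)
  then have "\<not> ?N \<subset> M"
    using assms(1) by (auto simp: generates_def)
  then show ?thesis using assms(3) by blast
qed

lemma difference_group_diff:
  assumes "additive_submonoid M" "x \<in> difference_group M" "y \<in> difference_group M"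
  shows "x - y \<in> difference_group M"
proof -
  obtain a b c d where *: "x = a - b" "y = c - d" "a \<in> M" "b \<in> M" "c \<in> M" "d \<in> M"
    using assms(2,3) by (auto simp: difference_group_def)
  then have "x - y = (a + d) - (b + c)" by simp
  moreover have "a + d \<in> M" "b + c \<in> M"
    using assms(1) * by (auto simp: additive_submonoid_def)
  ultimately show ?thesis unfolding difference_group_def by blast
qed

lemma subset_difference_group:
  assumes "additive_submonoid M"
  shows "M \<subseteq> difference_group M"
proof
  fix x assume "x \<in> M"
  moreover have "x = x - 0" "0 \<in> M" using assms by (auto simp: additive_submonoid_def)
  ultimately show "x \<in> difference_group M" unfolding difference_group_def by blast
qed

lemma nonneg_rat_nat_ratio:
  fixes t :: rat
  assumes "0 \<le> t"
  obtains i j :: nat where "j > 0" "of_nat j * t = of_nat i"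
proof -
  obtain p q where t: "t = Fract p q" "q > 0" by (cases t)
  then have "p \<ge> 0" using assms by (simp add: zero_le_Fract_iff)
  then have "of_nat (nat q) * t = of_nat (nat p)"
    using t by (simp add: Fract_of_int_quotient)
  then show ?thesis using that t(2) by (metis zero_less_nat_eq)
qed

lemma root_closure_nonneg:
  assumes "puiseux_monoid M" "x \<in> root_closure M"
  shows "0 \<le> x"
proof -
  obtain n :: nat where "n > 0" "of_nat n * x \<in> M"
    using assms(2) by (auto simp: root_closure_def)
  then have "n > 0" "0 \<le> of_nat n * x" using assms(1) by (auto simp: puiseux_monoid_def)
  then show ?thesis by (simp add: zero_le_mult_iff)
qed

text \<open>Any two positive rationals are commensurable, so some positive multiple of
  \<open>x\<close> is a multiple of \<open>m\<close> and thus lies in \<open>M\<close>. Membership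
  in the conductor then concerns translates by all nonnegative group elements.\<close>

lemma root_closure_eq:
  assumes "puiseux_monoid M" "m \<in> M" "m > 0"
  shows "root_closure M = {x \<in> difference_group M. 0 \<le> x}"
proof -
  have "x \<in> root_closure M" if x: "x \<in> difference_group M" "0 \<le> x" for x
  proof -
    have "0 \<le> x / m" using x(2) assms(3) by simp
    then obtain i j :: nat where ij: "j > 0" "of_nat j * (x / m) = of_nat i"
      by (rule nonneg_rat_nat_ratio)
    then have "of_nat j * x = of_nat i * m"
      using assms(3) by (simp add: field_simps)
    also have "\<dots> \<in> M"
      using assms by (intro additive_submonoid_of_nat_mult) (auto simp: puiseux_monoid_def)
    finally show ?thesis using x ij(1) by (auto simp: root_closure_def)
  qed
  then show ?thesis using root_closure_nonneg[OF assms(1)] by (auto simp: root_closure_def)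
qed

section \<open>Well-ordered sumsets\<close>

text \<open>Well-orderedness of a linearly ordered set, phrased by sequences: in this form it passes
  to sumsets by extracting subsequences. The next two lemmas give the equivalence with the existence
  of least elements.\<close>

definition inc_subseqs :: "'a::linorder set \<Rightarrow> bool" where
  "inc_subseqs W \<longleftrightarrow>
     (\<forall>f::nat \<Rightarrow> 'a. range f \<subseteq> W \<longrightarrow> (\<exists>r::nat \<Rightarrow> nat. strict_mono r \<and> incseq (f \<circ> r)))"

lemma inc_subseqs_least:
  assumes "inc_subseqs W" "X \<subseteq> W" "X \<noteq> {}"
  shows "\<exists>x\<in>X. \<forall>y\<in>X. x \<le> y"
proof (rule ccontr)
  assume "\<not> ?thesis"
  then have "\<exists>y. y \<in> X \<and> y < x" if "x \<in> X" for x
    using that by (meson linorder_not_le)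
  then have "\<exists>f. \<forall>n::nat. f n \<in> X \<and> f (Suc n) < f n"
    using assms(3) by (intro dependent_nat_choice) auto
  then obtain f :: "nat \<Rightarrow> 'a" where f: "\<And>n. f n \<in> X" "\<And>n. f (Suc n) < f n" by blast
  then have "range f \<subseteq> W" using assms(2) by auto
  then obtain r where r: "strict_mono r" "incseq (f \<circ> r)"
    using assms(1) unfolding inc_subseqs_def by blast
  have "r 0 < r 1" using r(1) by (simp add: strict_mono_def)
  then have "f (r 1) < f (r 0)"
    by (induction rule: less_Suc_induct) (auto intro: f(2) order.strict_trans)
  moreover have "f (r 0) \<le> f (r 1)" using r(2) by (auto simp: incseq_def)
  ultimately show False by simp
qed

text \<open>Every sequence has a monotone subsequence; if it is decreasing, it attains its least
  value and stays constant from there on, so a tail of it is increasing as well.\<close>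

lemma inc_subseqsI:
  assumes "\<And>X. X \<subseteq> W \<Longrightarrow> X \<noteq> {} \<Longrightarrow> \<exists>x\<in>X. \<forall>y\<in>X. x \<le> y"
  shows "inc_subseqs W"
  unfolding inc_subseqs_def
proof (intro allI impI)
  fix f :: "nat \<Rightarrow> 'a" assume f: "range f \<subseteq> W"
  obtain r :: "nat \<Rightarrow> nat" where r: "strict_mono r" "monoseq (f \<circ> r)"
    using seq_monosub[of f] by (auto simp: comp_def)
  show "\<exists>r. strict_mono r \<and> incseq (f \<circ> r)"
  proof (cases "incseq (f \<circ> r)")
    case False
    then have dec: "decseq (f \<circ> r)" using r(2) by (simp add: monoseq_iff)
    have "range (f \<circ> r) \<subseteq> W" using f by auto
    then obtain N where N: "\<And>n. f (r N) \<le> f (r n)"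
      using assms[of "range (f \<circ> r)"] by auto
    have "f (r (n + N)) = f (r N)" for n
      using N[of "n + N"] decseqD[OF dec, of N "n + N"] by (simp add: antisym)
    then have "incseq (f \<circ> (\<lambda>n. r (n + N)))" by (simp add: incseq_def)
    moreover have "strict_mono (\<lambda>n. r (n + N))" using r(1) by (simp add: strict_mono_def)
    ultimately show ?thesis by blast
  qed (use r in blast)
qed

text \<open>First thin out until the left summands increase, then thin out again for the right
  summands; the left ones still increase along the finer subsequence.\<close>

lemma inc_subseqs_set_plus:
  fixes U V :: "'a::linordered_ab_semigroup_add set"
  assumes "inc_subseqs U" "inc_subseqs V"
  shows "inc_subseqs {u + v | u v. u \<in> U \<and> v \<in> V}"
  unfolding inc_subseqs_def
proof (intro allI impI)
  fix f :: "nat \<Rightarrow> 'a" assume "range f \<subseteq> {u + v | u v. u \<in> U \<and> v \<in> V}"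
  then have "\<forall>n. \<exists>u v. f n = u + v \<and> u \<in> U \<and> v \<in> V" by blast
  then obtain u v where uv: "\<And>n. f n = u n + v n" "range u \<subseteq> U" "range v \<subseteq> V"
    by (auto simp: choice_iff image_subset_iff)
  obtain r where r: "strict_mono r" "incseq (u \<circ> r)"
    using assms(1) uv(2) unfolding inc_subseqs_def by blast
  have "range (v \<circ> r) \<subseteq> V" using uv(3) by auto
  then obtain q where q: "strict_mono q" "incseq ((v \<circ> r) \<circ> q)"
    using assms(2) unfolding inc_subseqs_def by blast
  have "strict_mono (r \<circ> q)" using r(1) q(1) by (rule strict_mono_o)
  moreover have "incseq (f \<circ> (r \<circ> q))"
    using r(2) q strict_mono_mono[OF q(1)]
    by (auto simp: incseq_def uv(1) intro!: add_mono dest: monoD)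
  ultimately show "\<exists>r. strict_mono r \<and> incseq (f \<circ> r)" by blast
qed

lemma incseq_range_least:
  fixes a :: "nat \<Rightarrow> 'a::linorder"
  assumes "incseq a" "X \<subseteq> range a" "X \<noteq> {}"
  shows "\<exists>x\<in>X. \<forall>y\<in>X. x \<le> y"
proof -
  define k where "k = (LEAST n. a n \<in> X)"
  have "\<exists>n. a n \<in> X" using assms by blast
  then have "a k \<in> X" unfolding k_def by (rule LeastI_ex)
  moreover have "a k \<le> y" if "y \<in> X" for y
  proof -
    obtain n where n: "y = a n" using assms(2) \<open>y \<in> X\<close> by blast
    then have "k \<le> n" using that unfolding k_def by (simp add: Least_le)
    then show ?thesis using assms(1) n by (simp add: incseqD)
  qed
  ultimately show ?thesis by blast
qed

text \<open>Sums of at most \<open>k\<close> elements of \<open>W\<close>, with repetition; allowing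
  the summand \<open>0\<close> turns "exactly" into "at most" and makes the family monotone in
  \<open>k\<close>.\<close>

primrec bounded_sums :: "'a::comm_monoid_add set \<Rightarrow> nat \<Rightarrow> 'a set" where
  "bounded_sums W 0 = {0}"
| "bounded_sums W (Suc k) = {u + v | u v. u \<in> bounded_sums W k \<and> v \<in> insert 0 W}"

lemma bounded_sums_mono: "j \<le> k \<Longrightarrow> bounded_sums W j \<subseteq> bounded_sums W k"
  by (rule lift_Suc_mono_le[of "bounded_sums W"]) force+

lemma bounded_sums_add:
  assumes "x \<in> bounded_sums W j" "y \<in> bounded_sums W k"
  shows "x + y \<in> bounded_sums W (j + k)"
  using assms(2)
proof (induction k arbitrary: y)
  case (Suc k)
  then obtain u v where "y = u + v" "u \<in> bounded_sums W k" "v \<in> insert 0 W" by auto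
  then have "x + y = (x + u) + v" "x + u \<in> bounded_sums W (j + k)" "v \<in> insert 0 W"
    using Suc.IH by (auto simp: add.assoc)
  then show ?case by (simp only: add_Suc_right bounded_sums.simps) blast
qed (use assms(1) in simp)

lemma inc_subseqs_bounded_sums:
  fixes W :: "'a::{linordered_ab_semigroup_add, comm_monoid_add} set"
  assumes "inc_subseqs (insert 0 W)"
  shows "inc_subseqs (bounded_sums W k)"
proof (induction k)
  case 0
  show ?case by (rule inc_subseqsI) (auto simp: subset_singleton_iff)
next
  case (Suc k)
  then show ?case using inc_subseqs_set_plus[OF Suc assms] by simp
qed

text \<open>The positive generators are bounded below by some \<open>b > 0\<close>, so an element of
  \<open>M\<close> that is at most \<open>z\<close> is a sum of at most \<open>z / b\<close> of
  them. Hence the part of \<open>X\<close> below \<open>z\<close> lies in a single well-ordered set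
  \<open>bounded_sums (range a) K\<close>.\<close>

lemma increasing_puiseux_least:
  assumes M: "puiseux_monoid M" "increasing_puiseux M" and X: "X \<subseteq> M" "X \<noteq> {}"
  shows "\<exists>x\<in>X. \<forall>y\<in>X. x \<le> y"
proof -
  have sub: "additive_submonoid M" using M(1) by (simp add: puiseux_monoid_def)
  obtain a :: "nat \<Rightarrow> rat" where a: "incseq a" "generates (range a) M"
    using M(2) by (auto simp: increasing_puiseux_def)
  have nonneg: "0 \<le> a n" for n
    using a(2) M(1) by (auto simp: generates_def puiseux_monoid_def)
  obtain b where b: "b > 0" "\<And>n. a n > 0 \<Longrightarrow> b \<le> a n"
  proof (cases "{x \<in> range a. x > 0} = {}")
    case True
    \<comment> \<open>Without positive generators the bound is vacuous, and any positive number
      serves as \<open>b\<close>.\<close>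
    then show ?thesis by (intro that[of 1]) auto
  next
    case False
    then obtain b where "b \<in> {x \<in> range a. x > 0}" "\<forall>y\<in>{x \<in> range a. x > 0}. b \<le> y"
      using incseq_range_least[OF a(1), of "{x \<in> range a. x > 0}"] by blast
    then show ?thesis by (intro that[of b]) auto
  qed
  have sums: "\<exists>k. x \<in> bounded_sums (range a) k \<and> of_nat k * b \<le> x" if "x \<in> M" for x
    using a(2) sub that
  proof (induction rule: generates_induct)
    case zero
    then show ?case by (intro exI[of _ 0]) auto
  next
    case (gen s)
    then obtain n where n: "s = a n" by auto
    show ?case
    proof (cases "s = 0")
      case True
      \<comment> \<open>A zero generator counts as the empty sum; counting it as one summand would
        break \<open>of_nat k * b \<le> x\<close>.\<close>
      then show ?thesis by (intro exI[of _ 0]) auto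
    next
      case False
      then have "b \<le> s" using n nonneg[of n] b(2)[of n] by auto
      then show ?thesis using n by (intro exI[of _ 1]) auto
    qed
  next
    case (add x y)
    then obtain j k where "x \<in> bounded_sums (range a) j" "of_nat j * b \<le> x"
      "y \<in> bounded_sums (range a) k" "of_nat k * b \<le> y" by blast
    then show ?case
      by (intro exI[of _ "j + k"]) (auto simp: bounded_sums_add distrib_right add_mono)
  qed
  have "inc_subseqs (insert 0 (range a))"
  proof (rule inc_subseqsI)
    fix Y assume Y: "Y \<subseteq> insert 0 (range a)" "Y \<noteq> {}"
    show "\<exists>x\<in>Y. \<forall>y\<in>Y. x \<le> y"
    proof (cases "0 \<in> Y")
      case True
      then show ?thesis using Y nonneg by (intro bexI[of _ 0]) auto
    next
      case False
      then show ?thesis using Y incseq_range_least[OF a(1), of Y] by auto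
    qed
  qed
  then have inc: "inc_subseqs (bounded_sums (range a) k)" for k
    by (rule inc_subseqs_bounded_sums)
  obtain z where z: "z \<in> X" using X(2) by blast
  define K where "K = nat \<lfloor>z / b\<rfloor>"
  have "x \<in> bounded_sums (range a) K" if "x \<in> X" "x \<le> z" for x
  proof -
    obtain k where k: "x \<in> bounded_sums (range a) k" "of_nat k * b \<le> x"
      using sums \<open>x \<in> X\<close> X(1) by blast
    then have "of_nat k \<le> z / b" using that(2) b(1) by (simp add: field_simps)
    then have "k \<le> K" unfolding K_def by (simp add: le_nat_floor le_floor_iff nat_le_iff le_nat_iff)
    then show ?thesis using k(1) bounded_sums_mono by blast
  qed
  then have "{x \<in> X. x \<le> z} \<subseteq> bounded_sums (range a) K" by blast
  moreover have "{x \<in> X. x \<le> z} \<noteq> {}" using z by auto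
  ultimately obtain x where x: "x \<in> X" "x \<le> z" "\<And>y. y \<in> X \<Longrightarrow> y \<le> z \<Longrightarrow> x \<le> y"
    using inc_subseqs_least[OF inc] by (metis (mono_tags, lifting) mem_Collect_eq)
  have "x \<le> y" if "y \<in> X" for y
    using x(2) x(3)[OF that] by (cases "y \<le> z") auto
  then show ?thesis using x(1) by blast
qed

section \<open>Density and discreteness\<close>

text \<open>The midpoint of \<open>u\<close> and \<open>v\<close> lies in the closure of
  \<open>A\<close>, and the interval between them is a relatively open neighbourhood of it.\<close>

lemma dense_in_subinterval:
  assumes "dense_in A {r<..<s}" "r \<le> u" "u < v" "v \<le> s"
  shows "\<exists>x\<in>A. u < x \<and> x < v"
proof -
  have "(u + v) / 2 \<in> {r<..<s}" using assms by (simp add: field_simps)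
  then have "(u + v) / 2 \<in> top_of_set {r<..<s} closure_of (A \<inter> {r<..<s})"
    using assms(1) by (simp add: dense_in_def)
  moreover have "openin (top_of_set {r<..<s}) {u<..<v}"
    by (rule open_openin_trans) (use assms in auto)
  moreover have "(u + v) / 2 \<in> {u<..<v}" using assms(3) by (simp add: field_simps)
  ultimately obtain y where "y \<in> A \<inter> {r<..<s}" "y \<in> {u<..<v}"
    unfolding in_closure_of by blast
  then show ?thesis by auto
qed

lemma increasing_nowhere_dense:
  assumes M: "puiseux_monoid M" "increasing_puiseux M"
  shows "nowhere_dense_puiseux M"
  unfolding nowhere_dense_puiseux_def
proof (intro allI impI notI)
  fix r s :: real
  assume rs: "0 \<le> r \<and> 0 \<le> s \<and> r < s" and dense: "dense_in (real_of_rat ` M) {r<..<s}"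
  let ?X = "{q \<in> M. r < real_of_rat q \<and> real_of_rat q < s}"
  have "?X \<noteq> {}" using dense_in_subinterval[OF dense, of r s] rs by auto
  \<comment> \<open>Density between \<open>r\<close> and the least element \<open>q\<close> produces
    a smaller element of the same set.\<close>
  then obtain q where q: "q \<in> ?X" "\<And>y. y \<in> ?X \<Longrightarrow> q \<le> y"
    using increasing_puiseux_least[OF M, of ?X] by blast
  then obtain p where p: "p \<in> M" "r < real_of_rat p" "real_of_rat p < real_of_rat q"
    using dense_in_subinterval[OF dense, of r "real_of_rat q"] by auto
  then have "p \<in> ?X" using q(1) by auto
  then show False using q(2)[of p] p(3) by (simp add: of_rat_less)
qed

text \<open>Cells of length \<open>g\<close> contain at most one point of \<open>X\<close> each, and
  finitely many cells cover the range from \<open>0\<close> to \<open>B\<close>.\<close>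

lemma finite_separated:
  fixes X :: "'a::floor_ceiling set"
  assumes "g > 0" "\<And>x. x \<in> X \<Longrightarrow> 0 \<le> x \<and> x \<le> B"
    and "\<And>x y. x \<in> X \<Longrightarrow> y \<in> X \<Longrightarrow> x < y \<Longrightarrow> g \<le> y - x"
  shows "finite X"
proof (rule finite_imageD)
  have "(\<lambda>x. \<lfloor>x / g\<rfloor>) ` X \<subseteq> {0..\<lfloor>B / g\<rfloor>}"
    using assms(1,2) by (auto intro!: floor_mono divide_right_mono)
  then show "finite ((\<lambda>x. \<lfloor>x / g\<rfloor>) ` X)" by (rule finite_subset) simp
  have neq: "\<lfloor>x / g\<rfloor> \<noteq> \<lfloor>y / g\<rfloor>" if "x \<in> X" "y \<in> X" "x < y" for x y
  proof -
    have "(x + g) / g \<le> y / g"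
      using assms(3)[OF that] assms(1) by (intro divide_right_mono) (auto simp: algebra_simps)
    then have "x / g + 1 \<le> y / g" using assms(1) by (simp add: add_divide_distrib)
    then have "\<lfloor>x / g + 1\<rfloor> \<le> \<lfloor>y / g\<rfloor>" by (rule floor_mono)
    then show ?thesis by simp
  qed
  then show "inj_on (\<lambda>x. \<lfloor>x / g\<rfloor>) X"
    by (intro inj_onI) (metis linorder_neqE)
qed

lemma common_denominator:
  fixes S :: "rat set"
  assumes "finite S"
  shows "\<exists>d::nat. d > 0 \<and> (\<forall>s\<in>S. of_nat d * s \<in> \<int>)"
  using assms
proof (induction S)
  case empty
  show ?case by auto
next
  case (insert t S)
  then obtain d :: nat where d: "d > 0" "\<forall>s\<in>S. of_nat d * s \<in> \<int>" by blast
  obtain p q where t: "t = Fract p q" "q > 0" by (cases t)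
  have "of_nat (nat q) * t = of_int p"
    using t by (simp add: Fract_of_int_quotient)
  then have qt: "of_nat (nat q) * t \<in> \<int>" by simp
  have "of_nat (d * nat q) * s \<in> \<int>" if "s \<in> insert t S" for s
  proof (cases "s = t")
    case True
    have "of_nat d * (of_nat (nat q) * t) \<in> \<int>" by (rule Ints_mult[OF _ qt]) simp
    then show ?thesis using True by (simp add: mult.assoc)
  next
    case False
    have "of_nat (nat q) * (of_nat d * s) \<in> \<int>"
      by (rule Ints_mult) (use d(2) that False in auto)
    then show ?thesis by (simp add: mult_ac)
  qed
  then show ?case using d(1) t(2) by (intro exI[of _ "d * nat q"]) auto
qed

section \<open>The conductor\<close>

text \<open>A common denominator \<open>d\<close> of the generators clears all denominators in the
  difference group, so distinct elements differ by at least \<open>1 / of_nat d\<close>.\<close>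

lemma finitely_generated_separated:
  assumes M: "additive_submonoid M" and fg: "finitely_generated M"
  obtains g where "g > 0"
    "\<And>x y. x \<in> difference_group M \<Longrightarrow> y \<in> difference_group M \<Longrightarrow> x < y \<Longrightarrow> g \<le> y - x"
proof -
  obtain S where S: "finite S" "generates S M"
    using fg by (auto simp: finitely_generated_def)
  obtain d :: nat where d: "d > 0" "\<And>s. s \<in> S \<Longrightarrow> of_nat d * s \<in> \<int>"
    using common_denominator[OF S(1)] by blast
  have "of_nat d * y \<in> \<int>" if "y \<in> M" for y
    using S(2) M that by (induction rule: generates_induct) (auto simp: d(2) distrib_left)
  then have int: "of_nat d * x \<in> \<int>" if "x \<in> difference_group M" for x
    using that by (auto simp: difference_group_def right_diff_distrib)
  show ?thesis
  proof (rule that[of "1 / of_nat d"])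
    fix x y assume xy: "x \<in> difference_group M" "y \<in> difference_group M" "x < y"
    have "of_nat d * (y - x) \<in> \<int>" using int[OF xy(1)] int[OF xy(2)]
      by (simp add: right_diff_distrib)
    moreover have "0 < of_nat d * (y - x)" using d(1) xy(3) by simp
    ultimately have "1 \<le> of_nat d * (y - x)" by (auto elim!: Ints_cases)
    then show "1 / of_nat d \<le> y - x" using d(1) by (simp add: field_simps)
  qed (use d(1) in simp)
qed

lemma finitely_generated_conductor:
  assumes M: "puiseux_monoid M" and m: "m \<in> M" "m > 0" and fg: "finitely_generated M"
  shows "conductor M \<noteq> {}"
proof -
  have sub: "additive_submonoid M" using M by (simp add: puiseux_monoid_def)
  let ?G = "difference_group M"
  obtain g where g: "g > 0" "\<And>x y. x \<in> ?G \<Longrightarrow> y \<in> ?G \<Longrightarrow> x < y \<Longrightarrow> g \<le> y - x"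
    using finitely_generated_separated[OF sub fg] by blast
  \<comment> \<open>The remainders of nonnegative group elements on division by
    \<open>m\<close>.\<close>
  define F where "F = {x \<in> ?G. 0 \<le> x \<and> x < m}"
  have "finite F" by (rule finite_separated[of g _ m]) (use g in \<open>auto simp: F_def\<close>)
  have "\<exists>z. z \<in> M \<and> f + z \<in> M" if "f \<in> F" for f
  proof -
    obtain a z where "f = a - z" "a \<in> M" "z \<in> M"
      using \<open>f \<in> F\<close> by (auto simp: F_def difference_group_def)
    then show ?thesis by (intro exI[of _ z]) auto
  qed
  then obtain z where z: "\<And>f. f \<in> F \<Longrightarrow> z f \<in> M" "\<And>f. f \<in> F \<Longrightarrow> f + z f \<in> M" by metis
  \<comment> \<open>Adding up all subtrahends serves every remainder at once: \<open>c + f\<close>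
    is \<open>f + z f\<close> plus the other values of \<open>z\<close>, all of them in
    \<open>M\<close>.\<close>
  define c where "c = sum z F"
  have "c + x \<in> M" if x: "x \<in> root_closure M" for x
  proof -
    have xG: "x \<in> ?G" "0 \<le> x" using x root_closure_nonneg[OF M] by (auto simp: root_closure_def)
    define k where "k = nat \<lfloor>x / m\<rfloor>"
    define f where "f = x - of_nat k * m"
    have "0 \<le> x / m" using xG m by simp
    then have "of_nat k \<le> x / m" "x / m < of_nat k + 1"
      by (simp_all add: k_def) linarith
    then have "0 \<le> f" "f < m" using m(2) by (auto simp: f_def field_simps)
    moreover have km: "of_nat k * m \<in> M" by (rule additive_submonoid_of_nat_mult[OF sub m(1)])
    then have "f \<in> ?G" unfolding f_def
      using xG(1) subset_difference_group[OF sub] by (intro difference_group_diff[OF sub]) auto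
    ultimately have "f \<in> F" by (simp add: F_def)
    then have "c + x = (f + z f) + sum z (F - {f}) + of_nat k * m"
      using \<open>finite F\<close> by (simp add: c_def f_def sum.remove[of F f])
    moreover have "sum z (F - {f}) \<in> M" by (rule additive_submonoid_sum[OF sub]) (use z in auto)
    ultimately show ?thesis
      using z(2)[OF \<open>f \<in> F\<close>] km sub by (auto simp: additive_submonoid_def)
  qed
  moreover have "c \<in> ?G"
    using additive_submonoid_sum[OF sub, of F z] z(1) subset_difference_group[OF sub]
    by (auto simp: c_def)
  ultimately have "c \<in> conductor M" by (auto simp: conductor_def)
  then show ?thesis by blast
qed

lemma conductor_finitely_generated:
  assumes M: "puiseux_monoid M" "increasing_puiseux M" and m: "m \<in> M" "m > 0"
    and x: "x \<in> conductor M"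
  shows "finitely_generated M"
proof -
  have sub: "additive_submonoid M" using M by (simp add: puiseux_monoid_def)
  let ?G = "difference_group M"
  have MG: "M \<subseteq> ?G" by (rule subset_difference_group[OF sub])
  have xG: "x \<in> ?G" using x by (simp add: conductor_def)
  have shift: "x + h \<in> M" if "h \<in> ?G" "0 \<le> h" for h
    using x that by (auto simp: conductor_def root_closure_eq[OF M(1) m])
  let ?P = "{h \<in> ?G. 0 < h}"
  \<comment> \<open>Translation by \<open>x\<close> moves \<open>?P\<close> into the well-ordered
    \<open>M\<close> and preserves order, so \<open>?P\<close> itself has a least element
    \<open>g\<close>, a lower bound for all gaps in the group.\<close>
  have "(\<lambda>h. x + h) ` ?P \<subseteq> M" "(\<lambda>h. x + h) ` ?P \<noteq> {}" using shift m MG by auto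
  then have "\<exists>w\<in>(\<lambda>h. x + h) ` ?P. \<forall>y\<in>(\<lambda>h. x + h) ` ?P. w \<le> y"
    by (rule increasing_puiseux_least[OF M])
  then obtain g where g: "g \<in> ?P" "\<And>h. h \<in> ?P \<Longrightarrow> g \<le> h" by auto
  define F where "F = insert m {y \<in> M. y < x + m}"
  have "finite {y \<in> M. y < x + m}"
  proof (rule finite_separated[of g _ "x + m"])
    fix y z assume "y \<in> {y \<in> M. y < x + m}" "z \<in> {y \<in> M. y < x + m}" "y < z"
    then show "g \<le> z - y" using MG by (intro g(2)) (auto intro!: difference_group_diff[OF sub])
  qed (use g M(1) in \<open>auto simp: puiseux_monoid_def\<close>)
  then have "finite F" by (simp add: F_def)
  \<comment> \<open>Descent by \<open>m\<close>: if \<open>y\<close> is at least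
    \<open>x + m\<close>, then \<open>y - m\<close> is \<open>x\<close> plus a nonnegative group
    element and so stays in \<open>M\<close>.\<close>
  have "y \<in> N" if N: "additive_submonoid N" "F \<subseteq> N" and y: "y \<in> M" for N y
    using y
  proof (induction "nat \<lfloor>y / m\<rfloor>" arbitrary: y rule: less_induct)
    case less
    show ?case
    proof (cases "y < x + m")
      case True
      then show ?thesis using less.prems N(2) by (auto simp: F_def)
    next
      case False
      have "(y - m) - x \<in> ?G"
        using less.prems m(1) MG xG by (auto intro!: difference_group_diff[OF sub])
      then have "y - m \<in> M" using shift[of "(y - m) - x"] False by simp
      then have "0 \<le> (y - m) / m" using M(1) m(2) by (auto simp: puiseux_monoid_def)
      moreover have "(y - m) / m = y / m - 1" using m(2) by (simp add: field_simps)
      \<comment> \<open>Nonnegativity of \<open>y - m\<close> makes \<open>y / m\<close> at least 1,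
        so truncation by \<open>nat\<close> does not spoil the strict decrease.\<close>
      ultimately have "nat \<lfloor>(y - m) / m\<rfloor> < nat \<lfloor>y / m\<rfloor>" by (simp add: le_floor_iff)
      then have "y - m \<in> N" using less.hyps \<open>y - m \<in> M\<close> by blast
      moreover have "m \<in> N" using N(2) by (simp add: F_def)
      ultimately have "(y - m) + m \<in> N" using N(1) unfolding additive_submonoid_def by blast
      then show ?thesis by simp
    qed
  qed
  then have "generates F M" using m(1) unfolding generates_def F_def by blast
  then show ?thesis using \<open>finite F\<close> by (auto simp: finitely_generated_def)
qed

theorem theorem4p9:
  fixes M :: "rat set"
  assumes "puiseux_monoid M" and "increasing_puiseux M"
  shows "nowhere_dense_puiseux M \<and> (conductor M \<noteq> {} \<longleftrightarrow> finitely_generated M)"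
proof (cases "\<exists>m\<in>M. m > 0")
  case True
  then show ?thesis
    using increasing_nowhere_dense[OF assms] finitely_generated_conductor[OF assms(1)]
      conductor_finitely_generated[OF assms] by blast
next
  case False
  \<comment> \<open>The trivial monoid has no positive \<open>m\<close> to divide by; here both
    sides of the equivalence hold outright.\<close>
  then have "M = {0}"
    using assms(1) by (force simp: puiseux_monoid_def additive_submonoid_def)
  then have "0 \<in> conductor M" "generates {0} M"
    by (auto simp: conductor_def root_closure_def difference_group_def generates_def)
  then have "conductor M \<noteq> {}" "finitely_generated M"
    by (auto simp: finitely_generated_def)
  then show ?thesis using increasing_nowhere_dense[OF assms] by simp
qed

end
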